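(* For each directed cycle $C=(\mathcal{V}^C,\mathcal{A}^C)\in\mathcal{C}$ of $\overrightarrow{G}$ let $\iota_C\in\mathcal{V}^C$ be any chosen vertex of $C$. If $(\hat\kappa,\hat w,\hat y)$ is feasible to the master problem $(\mathrm{MP2})$ and satisfies the cycle breaking inequality $$\sum_{(v,u)\in\mathcal{A}^C} w_{vu}\ \le\ |\mathcal{V}^C|-1+\mathbb{I}(|\mathcal{V}^C|\le K+1)\,\kappa_{\iota_C}$$ for every $C\in\mathcal{C}$, then $(\hat\kappa,\hat w,\hat y)\in \mathrm{proj}_{\kappa,w,y}(\mathcal{EF})$, i.e., there exists $\hat r$ such that $(\hat\kappa,\hat w,\hat y,\hat r)\in\mathcal{EF}$.
   Context: Let $K>0$ be an integer and $G=(\mathcal{V},\mathcal{E})$ a simple, connected, undirected graph with $n=|\mathcal{V}|$ vertices. For $v\in\mathcal{V}$, $\mathcal{N}(v)=\{u\in\mathcal{V}:\{u,v\}\in\mathcal{E}\}$. For an integer $a\ge 0$, $[a]=\{0,1,\dots,a\}$. $\mathbb{I}(\cdot)$ is the indicator function ($1$ if the argument is true, $0$ otherwise). $\overrightarrow{G}=(\mathcal{V},\mathcal{A})$ is the directed graph whose arcs are $(u,v)$ and $(v,u)$ for every $\{u,v\}\in\mathcal{E}$. $\mathcal{C}$ is the set of all directed cycles in $\overrightarrow{G}$; a cycle $C=(\mathcal{V}^C,\mathcal{A}^C)$ is a subgraph of $\overrightarrow{G}$ forming a directed path whose first node equals its last node (otherwise no repeated node; 2-cycles $u\to v\to u$ are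 included). The variables are $y\in\{0,1\}^{\mathcal{V}}$, $\kappa\in\{0,1\}^{\mathcal{V}}$, and $w$, with a component $w_{vu}\in\{0,1\}$ for every arc $(v,u)\in\mathcal{A}$ (so $w\in\{0,1\}^{2|\mathcal{E}|}$). A triple $(\kappa,w,y)$ is feasible to $(\mathrm{MP2})$ if it satisfies these domains and (1) $\sum_{v\in\mathcal{V}}\kappa_v=K+1$; (2) $\kappa_v+\kappa_u\le 1$ for all $v,u\in\mathcal{V}$ with $u\ne v$, $\{v,u\}\notin\mathcal{E}$; (3) $\kappa_v\le w_{uv}$ for all $v\in\mathcal{V}$, $u\in\mathcal{N}(v)$; (4) $\sum_{u\in\mathcal{N}(v)}w_{vu}=(K+1)(1-\kappa_v)-y_v+K\kappa_v$ for all $v\in\mathcal{V}$. (The objective of $(\mathrm{MP2})$ is to minimize $\sum_{v}y_v+1$.) $\mathcal{EF}$ is the feasible region of the extended formulation: the set of all $(\kappa,w,y,r)$ such that $(\kappa,w,y)$ is feasible to $(\mathrm{MP2})$, $r\in[n-1]^{\mathcal{V}}$, and (5) the values $r_v$, $v\in\mathcal{V}$, are pairwise different; (6) for all $v\in\mathcal{V}$: $\kappa_v=1\Rightarrow r_v\le K$; (7) for all $v\in\mathcal{V}$, $u\in\mathcal{N}(v)$: if $\kappa_v+\kappa_u=0$ and $w_{vu}=1$, then $r_u\le r_v-1$. *)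

theory Defs
  imports "Graph_Theory.Graph_Theory" "HOL-Library.FuncSet"
begin

(* The finite digraph with both orientations of every edge. It is loop-free
   because the edges of a simple graph have two distinct endpoints. *)
definition bidirected :: "'a set \<Rightarrow> 'a set set \<Rightarrow> 'a pair_pre_digraph" where
  "bidirected V E = \<lparr> pverts = V, parcs = {(u, v). {u, v} \<in> E} \<rparr>"

(* Graph_Theory.connected requires a nonempty vertex set. *)
definition simple_connected_graph :: "'a set \<Rightarrow> 'a set set \<Rightarrow> bool" where
  "simple_connected_graph V E \<longleftrightarrow>
     finite V \<and> (\<forall>e\<in>E. e \<subseteq> V \<and> card e = 2) \<and>
     Digraph_Component.connected (with_proj (bidirected V E))"

definition neighbors :: "'a set \<Rightarrow> 'a set set \<Rightarrow> 'a \<Rightarrow> 'a set" where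
  "neighbors V E v = {u \<in> V. {u, v} \<in> E}"

(* A cycle is a subgraph and not an arc list: rotations of the same closed walk
   are one cycle. Its vertices are the tails of its arcs. *)
definition dicycles :: "'a pair_pre_digraph \<Rightarrow> 'a pair_pre_digraph set" where
  "dicycles D =
     {\<lparr> pverts = fst ` set p, parcs = set p \<rparr> | p. pre_digraph.cycle (with_proj D) p}"

(* \<open>w (v, u)\<close> is the component of w at the arc from v to u. Vectors indexed by
   a set are extensional functions on that set. *)
definition MP2_feasible ::
    "nat \<Rightarrow> 'a set \<Rightarrow> 'a set set \<Rightarrow> ('a \<Rightarrow> int) \<Rightarrow> ('a \<times> 'a \<Rightarrow> int) \<Rightarrow> ('a \<Rightarrow> int) \<Rightarrow> bool" where
  "MP2_feasible K V E \<kappa> w y \<longleftrightarrow>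
     \<kappa> \<in> V \<rightarrow>\<^sub>E {0, 1} \<and>
     w \<in> parcs (bidirected V E) \<rightarrow>\<^sub>E {0, 1} \<and>
     y \<in> V \<rightarrow>\<^sub>E {0, 1} \<and>
     (\<Sum>v\<in>V. \<kappa> v) = int K + 1 \<and>
     (\<forall>v\<in>V. \<forall>u\<in>V. u \<noteq> v \<and> {v, u} \<notin> E \<longrightarrow> \<kappa> v + \<kappa> u \<le> 1) \<and>
     (\<forall>v\<in>V. \<forall>u\<in>neighbors V E v. \<kappa> v \<le> w (u, v)) \<and>
     (\<forall>v\<in>V. (\<Sum>u\<in>neighbors V E v. w (v, u)) =
              (int K + 1) * (1 - \<kappa> v) - y v + int K * \<kappa> v)"

definition EF ::
    "nat \<Rightarrow> 'a set \<Rightarrow> 'a set set \<Rightarrow>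
     (('a \<Rightarrow> int) \<times> ('a \<times> 'a \<Rightarrow> int) \<times> ('a \<Rightarrow> int) \<times> ('a \<Rightarrow> int)) set" where
  "EF K V E = {(\<kappa>, w, y, r).
     MP2_feasible K V E \<kappa> w y \<and>
     r \<in> V \<rightarrow>\<^sub>E {0 .. int (card V) - 1} \<and>
     inj_on r V \<and>
     (\<forall>v\<in>V. \<kappa> v = 1 \<longrightarrow> r v \<le> int K) \<and>
     (\<forall>v\<in>V. \<forall>u\<in>neighbors V E v. \<kappa> v + \<kappa> u = 0 \<and> w (v, u) = 1 \<longrightarrow> r u \<le> r v - 1)}"

definition proj_EF ::
    "nat \<Rightarrow> 'a set \<Rightarrow> 'a set set \<Rightarrow>
     (('a \<Rightarrow> int) \<times> ('a \<times> 'a \<Rightarrow> int) \<times> ('a \<Rightarrow> int)) set" where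
  "proj_EF K V E = {(\<kappa>, w, y). \<exists>r. (\<kappa>, w, y, r) \<in> EF K V E}"

definition cycle_breaking ::
    "nat \<Rightarrow> ('a \<Rightarrow> int) \<Rightarrow> ('a \<times> 'a \<Rightarrow> int) \<Rightarrow> 'a pair_pre_digraph \<Rightarrow> 'a \<Rightarrow> bool" where
  "cycle_breaking K \<kappa> w C i \<longleftrightarrow>
     (\<Sum>a\<in>parcs C. w a)
       \<le> int (card (pverts C)) - 1 + of_bool (card (pverts C) \<le> K + 1) * \<kappa> i"

end

theory Submission
  imports Defs
begin

text \<open>
  The coordinates \<^term>\<open>r\<close> of the extended formulation number the vertices from \<open>0\<close> to
  \<open>n - 1\<close> so that the clique \<open>{v. \<kappa> v = 1}\<close> receives numbers up to \<open>K\<close> and every selected arc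
  \<open>(v, u)\<close>, one with \<open>w (v, u) = 1\<close>, between two vertices outside the clique leads to a smaller
  number. The clique has exactly \<open>K + 1\<close> vertices, so its members may take the numbers
  \<open>0, \<dots>, K\<close> in any order, and the remaining vertices take \<open>K + 1, \<dots>, n - 1\<close>. What has to be found
  is an order of these remaining vertices against which all selected arcs between them run, that
  is, a topological order (\<open>ex_topological_numbering\<close>), and this exists as soon as these arcs
  contain no directed cycle (\<open>acyclic_parcs_if_no_cycle\<close>).

  The cycle breaking inequalities exclude such a cycle \<open>C\<close>: its chosen vertex lies outside the
  clique, so \<open>\<kappa>\<close> vanishes there and the right-hand side is \<open>|C| - 1\<close>. All of its at least \<open>|C|\<close> arcs are selected, which violates
  the inequality (\<open>cycle_breaking_excludes_selected_cycle\<close>).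
\<close>

text \<open>
  Some element of \<open>A\<close> has no successor in \<open>A\<close>, because the converse of a finite acyclic relation is
  well-founded. It can take the last number, and the others are numbered by induction.
\<close>
lemma ex_topological_numbering:
  assumes "finite A" "finite R" "acyclic R"
  shows "\<exists>f. bij_betw f A {..<card A} \<and> (\<forall>u\<in>A. \<forall>v\<in>A. (u, v) \<in> R \<longrightarrow> f u < (f v :: nat))"
  using assms(1)
proof (induction "card A" arbitrary: A)
  case 0
  then show ?case by (simp add: bij_betw_def)
next
  case (Suc n)
  have "wf (R\<inverse>)"
    using assms(2,3) by (rule finite_acyclic_wf_converse)
  moreover obtain a where "a \<in> A"
    using Suc.hyps(2) by fastforce
  ultimately obtain m where m: "m \<in> A" and last: "\<And>v. (v, m) \<in> R\<inverse> \<Longrightarrow> v \<notin> A"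
    by (rule wfE_min) blast
  have card: "card (A - {m}) = n"
    using Suc.hyps(2) Suc.prems m by simp
  obtain f where bij: "bij_betw f (A - {m}) {..<n}"
    and mono: "\<And>u v. u \<in> A - {m} \<Longrightarrow> v \<in> A - {m} \<Longrightarrow> (u, v) \<in> R \<Longrightarrow> f u < f v"
    using Suc.hyps(1)[OF card[symmetric]] Suc.prems card by auto
  define g where "g = f(m := n)"
  have "bij_betw g (A - {m}) {..<n}"
    using bij by (rule bij_betw_cong[THEN iffD1, rotated]) (simp add: g_def)
  moreover have "bij_betw g {m} {n}"
    by (simp add: g_def bij_betw_def)
  ultimately have "bij_betw g ((A - {m}) \<union> {m}) ({..<n} \<union> {n})"
    by (rule bij_betw_combine) auto
  moreover have "(A - {m}) \<union> {m} = A" "{..<n} \<union> {n} = {..<card A}"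
    using m Suc.hyps(2) by auto
  ultimately have "bij_betw g A {..<card A}"
    by simp
  moreover have "g u < g v" if "u \<in> A" "v \<in> A" "(u, v) \<in> R" for u v
  proof -
    have "u \<noteq> m"
      using last that by auto
    then show ?thesis
      using that mono bij_betwE[OF bij] by (cases "v = m") (auto simp: g_def)
  qed
  ultimately show ?case by blast
qed

text \<open>
  A vertex reachable from itself lies on a closed walk, and a shortest closed piece of that walk
  is a cycle.
\<close>
lemma (in pair_wf_digraph) acyclic_parcs_if_no_cycle:
  assumes "\<nexists>p. cycle p"
  shows "acyclic (parcs G)"
proof (rule acyclicI, rule allI, rule notI)
  fix x assume "(x, x) \<in> (parcs G)\<^sup>+"
  then obtain p where "awalk x p x" "p \<noteq> []"
    using reachable1_awalk by auto
  then have "closed_w p"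
    by (auto simp: closed_w_def)
  with assms closed_w_imp_cycle show False by blast
qed

text \<open>
  Every vertex of a cycle is the tail of one of its arcs. So there are at least \<open>card (pverts C)\<close>
  arcs, each adding \<open>1\<close> to the left-hand side, while \<open>\<kappa> i = 0\<close> removes the indicator term.
\<close>
lemma cycle_breaking_excludes_selected_cycle:
  assumes "C \<in> dicycles D" "\<And>a. a \<in> parcs C \<Longrightarrow> w a = 1" "\<kappa> i = 0"
  shows "\<not> cycle_breaking K \<kappa> w C i"
proof -
  obtain p where C: "C = \<lparr> pverts = fst ` set p, parcs = set p \<rparr>"
    using assms(1) unfolding dicycles_def by blast
  have "(\<Sum>a\<in>parcs C. w a) = int (card (set p))"
    using assms(2) by (simp add: C)
  moreover have "card (pverts C) \<le> card (set p)"
    by (simp add: C card_image_le)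
  ultimately show ?thesis
    by (simp add: cycle_breaking_def assms(3))
qed

theorem theorem1:
  fixes K :: nat
    and V :: "'a set" and E :: "'a set set"
    and \<iota> :: "'a pair_pre_digraph \<Rightarrow> 'a"
    and \<kappa> y :: "'a \<Rightarrow> int" and w :: "'a \<times> 'a \<Rightarrow> int"
  assumes "K > 0"
    and "simple_connected_graph V E"
    and "\<And>C. C \<in> dicycles (bidirected V E) \<Longrightarrow> \<iota> C \<in> pverts C"
    and "MP2_feasible K V E \<kappa> w y"
    and "\<And>C. C \<in> dicycles (bidirected V E) \<Longrightarrow> cycle_breaking K \<kappa> w C (\<iota> C)"
  shows "(\<kappa>, w, y) \<in> proj_EF K V E"
proof -
  have fin: "finite V" and edges: "\<And>u v. {u, v} \<in> E \<Longrightarrow> u \<in> V \<and> v \<in> V"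
    using assms(2) by (auto simp: simple_connected_graph_def)
  have kappa: "\<kappa> \<in> V \<rightarrow>\<^sub>E {0, 1}" and kappa_sum: "(\<Sum>v\<in>V. \<kappa> v) = int K + 1"
    using assms(4) by (auto simp: MP2_feasible_def)

  define Q where "Q = {v \<in> V. \<kappa> v = 1}"
  have Q: "Q \<subseteq> V" "finite Q"
    using fin by (auto simp: Q_def)
  have outside: "\<kappa> v = 0" if "v \<in> V - Q" for v
    using kappa that by (auto simp: Q_def PiE_iff)
  have "(\<Sum>v\<in>V. \<kappa> v) = (\<Sum>v\<in>Q. \<kappa> v)"
    by (rule sum.mono_neutral_right) (use fin Q outside in auto)
  also have "\<dots> = int (card Q)"
    by (simp add: Q_def)
  finally have card_Q: "card Q = Suc K"
    using kappa_sum by linarith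
  have card_V: "card V = Suc K + card (V - Q)"
    using card_Diff_subset[OF Q(2,1)] card_mono[OF fin Q(1)] card_Q by simp

  define S where "S = {(v, u). {v, u} \<in> E \<and> v \<in> V - Q \<and> u \<in> V - Q \<and> w (v, u) = 1}"
  define H where "H = \<lparr> pverts = V, parcs = S \<rparr>"
  interpret D: pair_wf_digraph "bidirected V E"
    by unfold_locales (auto simp: bidirected_def dest: edges)
  interpret H: pair_wf_digraph H
    by unfold_locales (auto simp: H_def S_def)
  have sub: "subgraph (with_proj H) (with_proj (bidirected V E))"
    unfolding subgraph_def
    using D.wf_digraph_axioms H.wf_digraph_axioms
    by (simp add: compatible_def) (auto simp: H_def S_def bidirected_def)
  have "\<not> H.cycle p" for p
  proof
    assume cyc: "H.cycle p"
    then have arcs: "set p \<subseteq> S"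
      unfolding H.cycle_def H.awalk_def by (auto simp: H_def)
    define C where "C = \<lparr> pverts = fst ` set p, parcs = set p \<rparr>"
    have C: "C \<in> dicycles (bidirected V E)"
      using D.subgraph_cycle[OF sub cyc] unfolding dicycles_def C_def by blast
    have "\<kappa> (\<iota> C) = 0"
      using assms(3)[OF C] arcs by (intro outside) (auto simp: C_def S_def)
    moreover have "w a = 1" if "a \<in> parcs C" for a
      using arcs that by (auto simp: C_def S_def)
    ultimately have "\<not> cycle_breaking K \<kappa> w C (\<iota> C)"
      by (intro cycle_breaking_excludes_selected_cycle[OF C]) auto
    with assms(5)[OF C] show False by contradiction
  qed
  then have "acyclic S"
    using H.acyclic_parcs_if_no_cycle by (simp add: H_def)
  moreover have "S \<subseteq> V \<times> V"
    by (auto simp: S_def)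
  then have "finite S"
    using fin finite_subset by blast
  \<comment> \<open>The converse is taken because heads of selected arcs must get the smaller numbers.\<close>
  ultimately obtain g where g: "bij_betw g (V - Q) {..<card (V - Q)}"
    and g_less: "\<And>u v. u \<in> V - Q \<Longrightarrow> v \<in> V - Q \<Longrightarrow> (v, u) \<in> S \<Longrightarrow> g u < (g v :: nat)"
    using ex_topological_numbering[of "V - Q" "S\<inverse>"] fin by auto
  obtain f where f: "bij_betw f Q {..<Suc K}"
    using ex_bij_betw_finite_nat[OF Q(2)] card_Q by (auto simp: atLeast0LessThan)
  have f_le: "f v \<le> K" if "v \<in> Q" for v
    using bij_betwE[OF f] that by (auto simp: less_Suc_eq_le)
  have g_bound: "g v < card (V - Q)" if "v \<in> V - Q" for v
    using bij_betwE[OF g] that by auto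

  define r where
    "r = restrict (\<lambda>v. if v \<in> Q then int (f v) else int K + 1 + int (g v)) V"
  have "r \<in> V \<rightarrow>\<^sub>E {0 .. int (card V) - 1}"
  proof (rule PiE_I)
    fix v assume "v \<in> V"
    then show "r v \<in> {0 .. int (card V) - 1}"
      using f_le[of v] g_bound[of v] card_V by (cases "v \<in> Q") (auto simp: r_def)
  qed (simp add: r_def)
  moreover have "inj_on r V"
  proof (rule inj_onI)
    fix u v assume uv: "u \<in> V" "v \<in> V" "r u = r v"
    \<comment> \<open>The value tells on which side of the clique a vertex lies, as only clique values are at most \<open>K\<close>.\<close>
    then have "u \<in> Q \<longleftrightarrow> v \<in> Q"
      using f_le[of u] f_le[of v] by (auto simp: r_def split: if_splits)
    with uv show "u = v"
      using bij_betw_imp_inj_on[OF f] bij_betw_imp_inj_on[OF g]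
      by (cases "v \<in> Q") (simp_all add: r_def inj_on_eq_iff)
  qed
  moreover have "\<forall>v\<in>V. \<kappa> v = 1 \<longrightarrow> r v \<le> int K"
    using f_le by (auto simp: r_def Q_def)
  moreover have "r u \<le> r v - 1"
    if "v \<in> V" "u \<in> neighbors V E v" "\<kappa> v + \<kappa> u = 0 \<and> w (v, u) = 1" for u v
  proof -
    have u: "u \<in> V" "{v, u} \<in> E"
      using that(2) by (auto simp: neighbors_def insert_commute)
    have "\<kappa> v \<ge> 0" "\<kappa> u \<ge> 0"
      using kappa that(1) u(1) by (auto simp: PiE_iff)
    then have "\<kappa> v \<noteq> 1" "\<kappa> u \<noteq> 1"
      using that(3) by linarith+
    then have "v \<in> V - Q" "u \<in> V - Q"
      using that(1) u(1) by (simp_all add: Q_def)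
    with u that(3) have "g u < g v"
      by (intro g_less) (auto simp: S_def)
    then show ?thesis
      using \<open>v \<in> V - Q\<close> \<open>u \<in> V - Q\<close> by (simp add: r_def)
  qed
  ultimately have "(\<kappa>, w, y, r) \<in> EF K V E"
    using assms(4) by (simp add: EF_def)
  then show ?thesis
    by (auto simp: proj_EF_def)
qed

end
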